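(* Let $X=\{X_j, j\ge 1\}$ be a sequence of independent random variables taking values in $\mathbb{Z}$, and let $S_n=\sum_{k=1}^nX_k$. Assume that $\vartheta_{X_j}>0$ for each $j$ and that the series $\sum_{j=1}^\infty\vartheta_{X_j}$ diverges. Put $\nu_n=\sum_{j=1}^n\vartheta_{X_j}$. Let $\alpha>\alpha'>0$ and $0<\varepsilon<1$. Then for each $n$ with $(1-\varepsilon)\nu_n>1$ such that $$|x|\le\frac12\sqrt{\frac{2\alpha\log\big((1-\varepsilon)\nu_n\big)}{(1-\varepsilon)\nu_n}}\quad\Longrightarrow\quad\frac{\sin x}{x}\ge(\alpha'/\alpha)^{1/2}$$ (for real $x$, with $\frac{\sin x}{x}$ read as $1$ at $x=0$), we have $$\sup_{u\ge 0}\ \sup_{d<\pi\sqrt{\frac{(1-\varepsilon)\nu_n}{2\alpha\log((1-\varepsilon)\nu_n)}}}\Big|\mathbb{P}\{d\,|\,S_n+u\}-\frac1d\Big|\le 2\,e^{-\frac{\varepsilon^2}{2}\nu_n}+\big((1-\varepsilon)\nu_n\big)^{-\alpha'},$$ where $u$ runs over the nonnegative integers and $d$ over the positive integers in the indicated range.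
   Context: For a random variable $Y$ with values in $\mathbb{Z}$, $\vartheta_Y=\sum_{k\in\mathbb{Z}}\mathbb{P}\{Y=k\}\wedge\mathbb{P}\{Y=k+1\}$, where $a\wedge b=\min(a,b)$. The notation $d\,|\,N$ means that $d$ divides the integer $N$. *)

theory Defs
  imports "HOL-Probability.Probability"
begin

(* The series is unconditionally summable: its terms are nonnegative and
   bounded by the point masses P{Y = k}, which sum to 1. *)
definition vartheta :: "'a measure \<Rightarrow> ('a \<Rightarrow> int) \<Rightarrow> real" where
  "vartheta M Y =
     (\<Sum>\<^sub>\<infinity>k\<in>UNIV. min (measure M {\<omega> \<in> space M. Y \<omega> = k})
                    (measure M {\<omega> \<in> space M. Y \<omega> = k + 1}))"

(* Sequences are indexed from 1; the value X 0 is never used. *)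
definition partial_sum :: "(nat \<Rightarrow> 'a \<Rightarrow> int) \<Rightarrow> nat \<Rightarrow> 'a \<Rightarrow> int" where
  "partial_sum X n \<omega> = (\<Sum>k=1..n. X k \<omega>)"

definition nu :: "'a measure \<Rightarrow> (nat \<Rightarrow> 'a \<Rightarrow> int) \<Rightarrow> nat \<Rightarrow> real" where
  "nu M X n = (\<Sum>j=1..n. vartheta M (X j))"

end

theory Submission
  imports Defs
begin

text \<open>
  Half of the mass \<open>\<theta> = \<Sum>\<^sub>k min (p k) (p (k + 1))\<close> can be placed on each of the two points
  \<open>k\<close> and \<open>k + 1\<close> without exceeding \<open>p\<close>. Hence the characteristic function of an integer
  variable with weights \<open>p\<close> is bounded by \<open>1 - \<theta> (1 - \<bar>cos (t / 2)\<bar>)\<close>. Finite Fourier inversion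
  modulo \<open>d\<close> bounds the error by the largest value of the characteristic function of \<open>S\<^sub>n\<close> at
  \<open>2 \<pi> j / d\<close>, \<open>0 < j < d\<close>, which is at most
  \<open>exp (- \<nu>\<^sub>n (1 - cos (\<pi> / d)))\<close>. With \<open>N = (1 - \<epsilon>) \<nu>\<^sub>n\<close>, the range of \<open>d\<close> and the
  condition on \<open>sin x / x\<close> give \<open>1 - cos (\<pi> / d) \<ge> \<alpha>' ln N / N\<close>, so that the error is at most
  \<open>exp (- \<nu>\<^sub>n \<alpha>' ln N / N) \<le> N powr (- \<alpha>')\<close>.
\<close>

section \<open>Characteristic functions of integer weights\<close>

lemma norm_one_plus_cis: "norm (1 + cis t) = 2 * \<bar>cos (t / 2)\<bar>"
proof -
  \<comment> \<open>Factoring out the phase of the midpoint between 1 and \<open>cis t\<close>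
    leaves a real number.\<close>
  have "1 + cis t = cis (t / 2) * (cis (t / 2) + cis (- (t / 2)))"
    by (simp only: distrib_left cis_mult) simp
  also have "cis (t / 2) + cis (- (t / 2)) = complex_of_real (2 * cos (t / 2))"
    by (simp add: complex_eq_iff)
  finally show ?thesis
    by (simp add: norm_mult)
qed

lemma integrable_scaleR_cis:
  assumes "integrable M f" and [measurable]: "g \<in> borel_measurable M"
  shows "integrable M (\<lambda>x. f x *\<^sub>R cis (g x))"
proof (rule Bochner_Integration.integrable_bound[OF assms(1)])
  have [measurable]: "f \<in> borel_measurable M"
    using assms(1) by auto
  have "cis \<in> borel_measurable borel"
    by (intro borel_measurable_continuous_onI continuous_intros)
  then show "(\<lambda>x. f x *\<^sub>R cis (g x)) \<in> borel_measurable M"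
    by measurable
qed simp

lemma norm_integral_scaleR_cis_le:
  assumes "\<And>x. f x \<ge> 0"
  shows "norm (\<integral>x. f x *\<^sub>R cis (g x) \<partial>M) \<le> (\<integral>x. f x \<partial>M)"
  using integral_norm_bound[of M "\<lambda>x. f x *\<^sub>R cis (g x)"] assms by simp

text \<open>The part of \<open>p\<close> carried by pairs of neighbours is a mixture of fair
  two-point laws on k, k + 1, each with a characteristic function of modulus \<bar>cos (t /
  2)\<bar>; the remaining mass is bounded trivially.\<close>

lemma norm_char_int_weights_le:
  fixes p :: "int \<Rightarrow> real"
  assumes nonneg: "\<And>k. p k \<ge> 0"
    and int: "integrable (count_space UNIV) p"
    and total: "(\<integral>k. p k \<partial>count_space UNIV) = 1"
  defines "m \<equiv> \<lambda>k. min (p k) (p (k + 1))"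
  shows "norm (\<integral>k. p k *\<^sub>R cis (t * real_of_int k) \<partial>count_space UNIV)
           \<le> 1 - (\<integral>k. m k \<partial>count_space UNIV) * (1 - \<bar>cos (t / 2)\<bar>)"
proof -
  let ?C = "count_space (UNIV :: int set)"
  define \<theta> where "\<theta> = (\<integral>k. m k \<partial>?C)"
  \<comment> \<open>The point k receives m k / 2 from the pair (k, k + 1) and m (k - 1) / 2 from (k
    - 1, k); \<open>r\<close> is what is left. Both m k and m (k - 1) are at most p k, so
    \<open>r\<close> is nonnegative.\<close>
  define r where "r k = p k - (m k + m (k - 1)) / 2" for k
  \<comment> \<open>This shift preserves counting measure, which allows \<open>m (k - 1)\<close> to
    be reindexed.\<close>
  have bij: "bij_betw (\<lambda>k. k + 1) (UNIV :: int set) UNIV"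
    by (rule bij_betw_byWitness[where f' = "\<lambda>k. k - 1"]) auto
  have m0: "m k \<ge> 0" for k
    using nonneg by (simp add: m_def)
  have r0: "r k \<ge> 0" for k
    by (simp add: r_def m_def)
  have m_int: "integrable ?C m"
    by (rule Bochner_Integration.integrable_bound[OF int]) (use nonneg in \<open>auto simp: m_def\<close>)
  have m'_int: "integrable ?C (\<lambda>k. m (k - 1))"
    using integrable_bij_count_space[OF bij, of "\<lambda>k. m (k - 1)"] m_int by simp
  have m'_total: "(\<integral>k. m (k - 1) \<partial>?C) = \<theta>"
    using integral_bij_count_space[OF bij, of "\<lambda>k. m (k - 1)"] by (simp add: \<theta>_def)
  have r_int: "integrable ?C r"
    unfolding r_def using int m_int m'_int by auto
  have r_total: "(\<integral>k. r k \<partial>?C) = 1 - \<theta>"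
    unfolding r_def using int m_int m'_int total m'_total by (simp add: \<theta>_def)
  define A where "A = (\<integral>k. m k *\<^sub>R cis (t * real_of_int k) \<partial>?C)"
  define R where "R = (\<integral>k. r k *\<^sub>R cis (t * real_of_int k) \<partial>?C)"
  have shift: "(\<integral>k. m (k - 1) *\<^sub>R cis (t * real_of_int k) \<partial>?C) = cis t * A"
  proof -
    have "(\<integral>k. m (k - 1) *\<^sub>R cis (t * real_of_int k) \<partial>?C)
        = (\<integral>k. m k *\<^sub>R cis (t * real_of_int (k + 1)) \<partial>?C)"
      using integral_bij_count_space[OF bij, of "\<lambda>k. m (k - 1) *\<^sub>R cis (t * real_of_int k)"]
      by simp
    also have "\<dots> = (\<integral>k. cis t * (m k *\<^sub>R cis (t * real_of_int k)) \<partial>?C)"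
      by (intro Bochner_Integration.integral_cong) (auto simp: cis_mult algebra_simps)
    also have "\<dots> = cis t * A"
      unfolding A_def by (rule integral_mult_right_zero)
    finally show ?thesis .
  qed
  have "(\<integral>k. p k *\<^sub>R cis (t * real_of_int k) \<partial>?C)
      = (\<integral>k. r k *\<^sub>R cis (t * real_of_int k)
            + (1 / 2) *\<^sub>R (m k *\<^sub>R cis (t * real_of_int k) + m (k - 1) *\<^sub>R cis (t * real_of_int k)) \<partial>?C)"
    by (intro Bochner_Integration.integral_cong refl)
       (simp add: r_def scaleR_left_distrib[symmetric] scaleR_scaleR del: scaleR_conv_of_real)
  also have "\<dots> = R + (1 / 2) *\<^sub>R (A + cis t * A)"
    using integrable_scaleR_cis[OF r_int, of "\<lambda>k. t * real_of_int k"]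
      integrable_scaleR_cis[OF m_int, of "\<lambda>k. t * real_of_int k"]
      integrable_scaleR_cis[OF m'_int, of "\<lambda>k. t * real_of_int k"]
    by (simp add: shift R_def[symmetric] A_def[symmetric])
  \<comment> \<open>The two halves differ only by the phase \<open>cis t\<close>, so they combine
    into a factor (1 + cis t) / 2 of modulus \<bar>cos (t / 2)\<bar>.\<close>
  also have "\<dots> = R + (1 / 2) *\<^sub>R ((1 + cis t) * A)"
    by (simp add: distrib_right)
  also have "norm \<dots> \<le> norm R + \<bar>cos (t / 2)\<bar> * norm A"
    by (rule order_trans[OF norm_triangle_ineq]) (simp add: norm_mult norm_one_plus_cis)
  also have "\<dots> \<le> (1 - \<theta>) + \<bar>cos (t / 2)\<bar> * \<theta>"
    using norm_integral_scaleR_cis_le[where f = r and M = ?C and g = "\<lambda>k. t * real_of_int k", OF r0]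
      norm_integral_scaleR_cis_le[where f = m and M = ?C and g = "\<lambda>k. t * real_of_int k", OF m0] r_total
    unfolding A_def R_def \<theta>_def by (intro add_mono mult_left_mono) simp_all
  finally show ?thesis
    by (simp add: \<theta>_def algebra_simps)
qed

section \<open>Characteristic functions of random variables and independent sums\<close>

context prob_space
begin

lemma distr_int_eq_density:
  fixes Y :: "'a \<Rightarrow> int"
  assumes [measurable]: "random_variable (count_space UNIV) Y"
  shows "distr M (count_space UNIV) Y
           = density (count_space UNIV) (\<lambda>k. ennreal (prob {\<omega> \<in> space M. Y \<omega> = k}))"
proof (rule measure_eqI_countable[of _ UNIV])
  fix k :: int
  have "Y -` {k} \<inter> space M = {\<omega> \<in> space M. Y \<omega> = k}"
    by auto
  then show "emeasure (distr M (count_space UNIV) Y) {k}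
      = emeasure (density (count_space UNIV) (\<lambda>k. ennreal (prob {\<omega> \<in> space M. Y \<omega> = k}))) {k}"
    by (simp add: emeasure_distr emeasure_density emeasure_eq_measure nn_integral_indicator_singleton)
qed auto

lemma norm_char_int_le:
  fixes Y :: "'a \<Rightarrow> int"
  assumes Y [measurable]: "random_variable (count_space UNIV) Y"
  shows "norm (expectation (\<lambda>\<omega>. cis (t * real_of_int (Y \<omega>))))
           \<le> 1 - vartheta M Y * (1 - \<bar>cos (t / 2)\<bar>)"
proof -
  define p where "p k = prob {\<omega> \<in> space M. Y \<omega> = k}" for k
  let ?C = "count_space (UNIV :: int set)"
  have p0: "p k \<ge> 0" for k
    by (simp add: p_def)
  note D = distr_int_eq_density[OF Y, folded p_def]
  have "prob_space (distr M ?C Y)"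
    by (rule prob_space_distr) simp
  then have "emeasure (density ?C (\<lambda>k. ennreal (p k))) UNIV = 1"
    unfolding D using prob_space.emeasure_space_1 by fastforce
  then have nn: "(\<integral>\<^sup>+k. ennreal (p k) \<partial>?C) = 1"
    by (simp add: emeasure_density)
  have int: "integrable ?C p"
    using nn p0 by (intro integrableI_nonneg) auto
  have total: "(\<integral>k. p k \<partial>?C) = 1"
    using nn p0 by (subst integral_eq_nn_integral) auto
  \<comment> \<open>Absolute summability identifies the unordered sum in \<open>vartheta\<close>
    with an integral over counting measure.\<close>
  have "integrable ?C (\<lambda>k. min (p k) (p (k + 1)))"
    by (rule Bochner_Integration.integrable_bound[OF int]) (use p0 in auto)
  then have th: "vartheta M Y = (\<integral>k. min (p k) (p (k + 1)) \<partial>?C)"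
    unfolding vartheta_def p_def[symmetric]
    by (subst infsetsum_infsum[symmetric]) (auto simp: abs_summable_on_def infsetsum_def)
  have "expectation (\<lambda>\<omega>. cis (t * real_of_int (Y \<omega>)))
      = (\<integral>k. cis (t * real_of_int k) \<partial>distr M ?C Y)"
    by (subst integral_distr) auto
  also have "\<dots> = (\<integral>k. p k *\<^sub>R cis (t * real_of_int k) \<partial>?C)"
    unfolding D by (subst integral_density) (use p0 in auto)
  finally show ?thesis
    using norm_char_int_weights_le[OF p0 int total] th by simp
qed

text \<open>Independence turns the expectation into a product, and 1 - x \<le> exp (- x) turns the
  product of the individual bounds into one exponential of the summed
  \<open>vartheta\<close>.\<close>

lemma norm_char_sum_le:
  fixes X :: "nat \<Rightarrow> 'a \<Rightarrow> int"
  assumes "finite I" and indep: "indep_vars (\<lambda>_. count_space UNIV) X I"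
  shows "norm (expectation (\<lambda>\<omega>. cis (t * real_of_int (\<Sum>i\<in>I. X i \<omega>))))
           \<le> exp (- (\<Sum>i\<in>I. vartheta M (X i)) * (1 - \<bar>cos (t / 2)\<bar>))"
proof -
  have rv [measurable]: "random_variable (count_space UNIV) (X i)" if "i \<in> I" for i
    using indep that by (auto simp: indep_vars_def)
  have cis_sum: "cis (t * real_of_int (\<Sum>i\<in>I. X i \<omega>)) = (\<Prod>i\<in>I. cis (t * real_of_int (X i \<omega>)))" for \<omega>
    using \<open>finite I\<close> by induction (simp_all add: cis_mult[symmetric] distrib_left)
  have "indep_vars (\<lambda>_. borel) (\<lambda>i \<omega>. cis (t * real_of_int (X i \<omega>))) I"
    by (rule indep_vars_compose2[OF indep]) auto
  moreover have "integrable M (\<lambda>\<omega>. cis (t * real_of_int (X i \<omega>)))" if "i \<in> I" for i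
    using integrable_scaleR_cis[of M "\<lambda>_. 1"] rv[OF that] by simp
  ultimately have "expectation (\<lambda>\<omega>. cis (t * real_of_int (\<Sum>i\<in>I. X i \<omega>)))
      = (\<Prod>i\<in>I. expectation (\<lambda>\<omega>. cis (t * real_of_int (X i \<omega>))))"
    unfolding cis_sum using \<open>finite I\<close> by (intro indep_vars_lebesgue_integral) auto
  also have "norm \<dots> \<le> (\<Prod>i\<in>I. exp (- vartheta M (X i) * (1 - \<bar>cos (t / 2)\<bar>)))"
    unfolding prod_norm[symmetric]
  proof (intro prod_mono conjI norm_ge_zero)
    fix i assume "i \<in> I"
    have "norm (expectation (\<lambda>\<omega>. cis (t * real_of_int (X i \<omega>))))
        \<le> 1 + - vartheta M (X i) * (1 - \<bar>cos (t / 2)\<bar>)"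
      using norm_char_int_le[OF rv[OF \<open>i \<in> I\<close>], of t] by simp
    also have "\<dots> \<le> exp (- vartheta M (X i) * (1 - \<bar>cos (t / 2)\<bar>))"
      by (rule exp_ge_add_one_self)
    finally show "norm (expectation (\<lambda>\<omega>. cis (t * real_of_int (X i \<omega>))))
        \<le> exp (- vartheta M (X i) * (1 - \<bar>cos (t / 2)\<bar>))" .
  qed
  also have "\<dots> = exp (- (\<Sum>i\<in>I. vartheta M (X i)) * (1 - \<bar>cos (t / 2)\<bar>))"
    using \<open>finite I\<close> by (simp add: exp_sum[symmetric] sum_negf sum_distrib_right)
  finally show ?thesis .
qed

end

section \<open>Divisibility probabilities by Fourier inversion modulo d\<close>

lemma measurable_sum_int_count_space:
  fixes X :: "'i \<Rightarrow> 'a \<Rightarrow> int"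
  assumes "finite I" and "\<And>i. i \<in> I \<Longrightarrow> X i \<in> measurable M (count_space UNIV)"
  shows "(\<lambda>\<omega>. \<Sum>i\<in>I. X i \<omega>) \<in> measurable M (count_space UNIV)"
  using assms
proof (induction I)
  case (insert i I)
  then have [measurable]: "X i \<in> measurable M (count_space UNIV)"
    "(\<lambda>\<omega>. \<Sum>i\<in>I. X i \<omega>) \<in> measurable M (count_space UNIV)"
    by auto
  have "(\<lambda>\<omega>. X i \<omega> + (\<Sum>i\<in>I. X i \<omega>)) \<in> measurable M (count_space UNIV)"
    \<comment> \<open>The integers are countable, so it suffices to fix the value \<open>a\<close>
      of \<open>X i\<close>.\<close>
    by (rule measurable_compose_countable[where f = "\<lambda>a \<omega>. a + (\<Sum>i\<in>I. X i \<omega>)"]) measurable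
  then show ?case
    using insert.hyps by simp
qed simp

text \<open>The summands are the powers of a d-th root of unity \<open>w\<close>, which equals 1
  exactly when d divides z; otherwise the geometric sum vanishes.\<close>

lemma sum_cis_eq_of_bool_dvd:
  fixes d :: nat and z :: int
  assumes "d > 0"
  shows "(\<Sum>j<d. cis (2 * pi * real j / real d * real_of_int z)) = of_nat d * of_bool (int d dvd z)"
proof -
  define w where "w = cis (2 * pi * (real_of_int z / real d))"
  have pow: "cis (2 * pi * real j / real d * real_of_int z) = w ^ j" for j
    unfolding w_def Complex.DeMoivre by (rule arg_cong[of _ _ cis]) simp
  show ?thesis
  proof (cases "int d dvd z")
    case True
    then obtain q where "z = int d * q" ..
    then have "w = 1"
      using \<open>d > 0\<close> by (simp add: w_def)
    then show ?thesis
      unfolding pow using True by simp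
  next
    case False
    have "w \<noteq> 1"
    proof
      assume "w = 1"
      then have "cos (2 * pi * (real_of_int z / real d)) = 1"
        by (simp add: w_def complex_eq_iff)
      then obtain q :: int where "2 * pi * (real_of_int z / real d) = of_int q * 2 * pi"
        using cos_one_2pi_int by auto
      then have "real_of_int z = real_of_int q * real d"
        using \<open>d > 0\<close> by (simp add: field_simps)
      then have "real_of_int z = real_of_int (q * int d)"
        by simp
      then have "z = q * int d"
        by (simp only: of_int_eq_iff)
      then show False
        using False by simp
    qed
    moreover have "w ^ d = 1"
      unfolding pow[symmetric] using \<open>d > 0\<close> by (simp add: cis_multiple_2pi)
    ultimately show ?thesis
      unfolding pow using False by (simp add: geometric_sum)
  qed
qed

text \<open>Taking expectations in the root-of-unity identity expresses d times the probability as a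
  sum of values of the characteristic function. The frequency j = 0 contributes 1, which accounts
  for 1 / d; the others form the error.\<close>

lemma (in prob_space) abs_prob_dvd_diff_le:
  fixes Z :: "'a \<Rightarrow> int"
  assumes [measurable]: "random_variable (count_space UNIV) Z" and "d > 0" and "B \<ge> 0"
    and bound: "\<And>j. 0 < j \<Longrightarrow> j < d \<Longrightarrow>
      norm (expectation (\<lambda>\<omega>. cis (2 * pi * real j / real d * real_of_int (Z \<omega>)))) \<le> B"
  shows "\<bar>prob {\<omega> \<in> space M. int d dvd Z \<omega>} - 1 / real d\<bar> \<le> B"
proof -
  let ?E = "\<lambda>j. expectation (\<lambda>\<omega>. cis (2 * pi * real j / real d * real_of_int (Z \<omega>)))"
  let ?A = "{\<omega> \<in> space M. int d dvd Z \<omega>}"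
  have [measurable]: "?A \<in> sets M"
    by measurable
  have int: "integrable M (\<lambda>\<omega>. cis (2 * pi * real j / real d * real_of_int (Z \<omega>)))" for j
    using integrable_scaleR_cis[of M "\<lambda>_. 1" "\<lambda>\<omega>. 2 * pi * real j / real d * real_of_int (Z \<omega>)"]
    by simp
  have "(\<Sum>j<d. ?E j) = expectation (\<lambda>\<omega>. \<Sum>j<d. cis (2 * pi * real j / real d * real_of_int (Z \<omega>)))"
    using int by simp
  also have "\<dots> = expectation (\<lambda>\<omega>. complex_of_real (real d * indicator ?A \<omega>))"
  proof (rule Bochner_Integration.integral_cong[OF refl])
    fix \<omega> assume "\<omega> \<in> space M"
    then show "(\<Sum>j<d. cis (2 * pi * real j / real d * real_of_int (Z \<omega>)))
        = complex_of_real (real d * indicator ?A \<omega>)"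
      unfolding sum_cis_eq_of_bool_dvd[OF \<open>d > 0\<close>] by (simp add: indicator_def)
  qed
  also have "\<dots> = complex_of_real (real d * prob ?A)"
    by (subst integral_complex_of_real) simp
  finally have sum_eq: "complex_of_real (real d * prob ?A) = (\<Sum>j<d. ?E j)" ..
  have "{..<d} = insert 0 {1..<d}"
    using \<open>d > 0\<close> by auto
  then have "(\<Sum>j<d. ?E j) = 1 + (\<Sum>j=1..<d. ?E j)"
    by (simp add: prob_space)
  then have "complex_of_real (real d * prob ?A - 1) = (\<Sum>j=1..<d. ?E j)"
    using sum_eq by simp
  then have "\<bar>real d * prob ?A - 1\<bar> = norm (\<Sum>j=1..<d. ?E j)"
    unfolding norm_of_real[symmetric, where 'a = complex] by (rule arg_cong)
  also have "\<dots> \<le> (\<Sum>j=1..<d. B)"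
    by (rule sum_norm_le) (use bound in auto)
  \<comment> \<open>There are d - 1 terms, and B is nonnegative.\<close>
  also have "\<dots> \<le> real d * B"
    using \<open>B \<ge> 0\<close> by (simp add: mult_right_mono)
  also have "real d * prob ?A - 1 = real d * (prob ?A - 1 / real d)"
    using \<open>d > 0\<close> by (simp add: right_diff_distrib)
  finally have "real d * \<bar>prob ?A - 1 / real d\<bar> \<le> real d * B"
    by (simp only: abs_mult abs_of_nat)
  then show ?thesis
    using \<open>d > 0\<close> by (simp only: mult_le_cancel_left_pos of_nat_0_less_iff)
qed

section \<open>Trigonometric lower bound at nonzero frequencies\<close>

lemma abs_cos_le_cos:
  assumes "0 \<le> a" "a \<le> x" "x \<le> pi - a"
  shows "\<bar>cos x\<bar> \<le> cos a"
proof -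
  have "cos x \<le> cos a"
    using assms by (intro cos_monotone_0_pi_le) auto
  moreover have "cos (pi - x) \<le> cos a"
    using assms by (intro cos_monotone_0_pi_le) auto
  ultimately show ?thesis
    by simp
qed

text \<open>The points pi * j / d with 0 < j < d keep distance at least pi / d \<ge> 2 * \<phi> from
  0 and pi, so \<bar>cos\<bar> is at most cos (2 * \<phi>) = 1 - 2 * (sin \<phi>)^2 there. It is
  applied with \<phi> half of \<open>L\<close> and c the lower bound for
  \<open>sinc\<close>.\<close>

lemma one_minus_abs_cos_ge:
  fixes d j :: nat and \<phi> c :: real
  assumes "\<phi> > 0" "c \<ge> 0" "sin \<phi> \<ge> c * \<phi>" "2 * \<phi> \<le> pi / real d" "0 < j" "j < d"
  shows "1 - \<bar>cos (pi * real j / real d)\<bar> \<ge> 2 * c\<^sup>2 * \<phi>\<^sup>2"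
proof -
  have "pi / real d \<le> pi * real j / real d"
    using assms by (simp add: divide_simps)
  moreover have "pi * real j / real d \<le> pi - pi / real d"
  proof -
    have "pi * (real j + 1) \<le> pi * real d"
      using assms by (intro mult_left_mono) auto
    then show ?thesis
      using assms by (simp add: field_simps)
  qed
  ultimately have "\<bar>cos (pi * real j / real d)\<bar> \<le> cos (2 * \<phi>)"
    using assms by (intro abs_cos_le_cos) auto
  also have "\<dots> = 1 - 2 * (sin \<phi>)\<^sup>2"
    by (rule cos_double_sin)
  finally have "2 * (sin \<phi>)\<^sup>2 \<le> 1 - \<bar>cos (pi * real j / real d)\<bar>"
    by simp
  moreover have "(c * \<phi>)\<^sup>2 \<le> (sin \<phi>)\<^sup>2"
    using assms by (intro power_mono) auto
  ultimately show ?thesis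
    by (simp add: power_mult_distrib)
qed

theorem theorem4p3:
  fixes M :: "'a measure"
    and X :: "nat \<Rightarrow> 'a \<Rightarrow> int"
    and \<alpha> \<alpha>' \<epsilon> :: real
    and n :: nat
  assumes "prob_space M"
    and "prob_space.indep_vars M (\<lambda>_. count_space UNIV) X {1..}"
    and "\<And>j. j \<ge> 1 \<Longrightarrow> vartheta M (X j) > 0"
    and "\<not> summable (\<lambda>j. vartheta M (X (Suc j)))"
    and "\<alpha> > \<alpha>'" and "\<alpha>' > 0"
    and "0 < \<epsilon>" and "\<epsilon> < 1"
    and "(1 - \<epsilon>) * nu M X n > 1"
    and "\<And>x :: real.
           \<bar>x\<bar> \<le> 1 / 2 * sqrt (2 * \<alpha> * ln ((1 - \<epsilon>) * nu M X n) / ((1 - \<epsilon>) * nu M X n))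
             \<Longrightarrow> sinc x \<ge> (\<alpha>' / \<alpha>) powr (1 / 2)"
  shows "(SUP u \<in> (UNIV :: nat set).
            SUP d \<in> {d :: nat. d \<ge> 1 \<and>
                real d < pi * sqrt ((1 - \<epsilon>) * nu M X n / (2 * \<alpha> * ln ((1 - \<epsilon>) * nu M X n)))}.
              ereal \<bar>measure M {\<omega> \<in> space M. int d dvd partial_sum X n \<omega> + int u} - 1 / real d\<bar>)
         \<le> ereal (2 * exp (- (\<epsilon>\<^sup>2 / 2) * nu M X n) + ((1 - \<epsilon>) * nu M X n) powr (- \<alpha>'))"
proof -
  interpret prob_space M
    by fact
  define \<nu> where "\<nu> = nu M X n"
  define N where "N = (1 - \<epsilon>) * \<nu>"
  \<comment> \<open>\<open>L / 2\<close> is the largest argument allowed in the condition on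
    \<open>sinc\<close>, while \<open>pi / L\<close> is the upper limit for d. The condition is used
    only at this endpoint.\<close>
  define L where "L = sqrt (2 * \<alpha> * ln N / N)"
  have N: "N > 1"
    using assms(9) by (simp add: N_def \<nu>_def)
  then have ln: "ln N > 0"
    by simp
  have "\<nu> > 0"
    using N assms(8) by (metis N_def diff_gt_0_iff_gt less_trans zero_less_mult_pos zero_less_one)
  then have "N \<le> \<nu>"
    using assms(7) by (simp add: N_def algebra_simps)
  have \<alpha>: "\<alpha> > 0"
    using assms(5,6) by simp
  have L: "L > 0"
    using N ln \<alpha> by (simp add: L_def)
  define c where "c = (\<alpha>' / \<alpha>) powr (1 / 2)"
  have c0: "c \<ge> 0"
    by (simp add: c_def)
  have "\<bar>L / 2\<bar> \<le> 1 / 2 * L"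
    using L by simp
  then have "c \<le> sinc (L / 2)"
    unfolding c_def L_def N_def \<nu>_def by (rule assms(10))
  then have "c \<le> sin (L / 2) / (L / 2)"
    using L by simp
  then have sin: "sin (L / 2) \<ge> c * (L / 2)"
    using L by (simp add: field_simps)
  \<comment> \<open>The square of \<open>c\<close> is \<alpha>' / \<alpha>, which replaces \<alpha>
    by \<alpha>' in half the square of \<open>L\<close>.\<close>
  have gap: "2 * c\<^sup>2 * (L / 2)\<^sup>2 = \<alpha>' * ln N / N"
  proof -
    have "c\<^sup>2 = \<alpha>' / \<alpha>"
      using \<alpha> assms(6) by (simp add: c_def powr_half_sqrt)
    moreover have "L\<^sup>2 = 2 * \<alpha> * ln N / N"
      using \<alpha> ln N by (simp add: L_def)
    ultimately show ?thesis
      using \<alpha> by (simp add: power_divide)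
  qed
  have indep: "indep_vars (\<lambda>_. count_space UNIV) X {1..n}"
    by (rule indep_vars_subset[OF assms(2)]) auto
  have S [measurable]: "random_variable (count_space UNIV) (partial_sum X n)"
  proof -
    have "random_variable (count_space UNIV) (X i)" if "i \<in> {1..n}" for i
      using indep that by (auto simp: indep_vars_def)
    then show ?thesis
      unfolding partial_sum_def[abs_def] by (intro measurable_sum_int_count_space) auto
  qed
  have main: "\<bar>prob {\<omega> \<in> space M. int d dvd partial_sum X n \<omega> + int u} - 1 / real d\<bar> \<le> N powr (- \<alpha>')"
    if d: "d \<ge> 1" "real d < pi * sqrt (N / (2 * \<alpha> * ln N))" for u d :: nat
  proof (rule abs_prob_dvd_diff_le)
    have "sqrt (N / (2 * \<alpha> * ln N)) = 1 / L"
      by (simp add: L_def real_sqrt_divide)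
    then have "real d < pi / L"
      using d(2) by simp
    then have Ld: "2 * (L / 2) \<le> pi / real d"
      using d(1) L by (simp add: field_simps)
    fix j :: nat assume j: "0 < j" "j < d"
    let ?t = "2 * pi * real j / real d"
    have "\<alpha>' * ln N / N \<le> 1 - \<bar>cos (?t / 2)\<bar>"
      using one_minus_abs_cos_ge[OF _ c0 sin Ld j] L gap by simp
    \<comment> \<open>Since N \<le> \<nu>, the exponent is at least \<alpha>' * ln N, which yields
      exactly the power of N.\<close>
    then have "N * (\<alpha>' * ln N / N) \<le> \<nu> * (1 - \<bar>cos (?t / 2)\<bar>)"
      using \<open>N \<le> \<nu>\<close> N ln assms(6) by (intro mult_mono) auto
    then have *: "exp (- \<nu> * (1 - \<bar>cos (?t / 2)\<bar>)) \<le> N powr (- \<alpha>')"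
      using N by (simp add: powr_def)
    \<comment> \<open>Shifting by u only multiplies by a unimodular constant, so the bound is
      uniform in u.\<close>
    have "expectation (\<lambda>\<omega>. cis (?t * real_of_int (partial_sum X n \<omega> + int u)))
        = expectation (\<lambda>\<omega>. cis (?t * real u) * cis (?t * real_of_int (partial_sum X n \<omega>)))"
      unfolding cis_mult by (simp add: distrib_left add.commute)
    also have "\<dots> = cis (?t * real u) * expectation (\<lambda>\<omega>. cis (?t * real_of_int (partial_sum X n \<omega>)))"
      by simp
    also have "norm \<dots> = norm (expectation (\<lambda>\<omega>. cis (?t * real_of_int (partial_sum X n \<omega>))))"
      by (simp only: norm_mult norm_cis mult_1)
    also have "\<dots> \<le> exp (- \<nu> * (1 - \<bar>cos (?t / 2)\<bar>))"
      unfolding partial_sum_def \<nu>_def nu_def by (rule norm_char_sum_le[OF _ indep]) simp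
    finally show "norm (expectation (\<lambda>\<omega>. cis (?t * real_of_int (partial_sum X n \<omega> + int u))))
        \<le> N powr (- \<alpha>')"
      using * by (rule order_trans)
  qed (use d in auto)
  have "N powr (- \<alpha>') \<le> 2 * exp (- (\<epsilon>\<^sup>2 / 2) * \<nu>) + N powr (- \<alpha>')"
    by simp
  then show ?thesis
    unfolding \<nu>_def[symmetric] N_def[symmetric]
    \<comment> \<open>In \<open>ereal\<close> the pointwise bound passes to both suprema, even over
      an empty range of d.\<close>
    by (intro SUP_least) (auto intro: order_trans[OF main])
qed

end
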